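(* Let $M_1=(E_1,r_1)$ and $M_2=(E_2,r_2)$ be two $q$-matroids with trivially intersecting ground spaces $E_1,E_2$ over the same field, let $E=E_1\oplus E_2$, and let $M_1\oplus M_2$ be their direct sum. Then for any $A\subseteq E$ of the form $A=A_1\oplus A_2$ with $A_1\subseteq E_1$ and $A_2\subseteq E_2$ it holds that $$r(M_1\oplus M_2;A)=r(M_1;A_1)+r(M_2;A_2).$$
   Context: A $q$-matroid is a pair $(E,r)$, where $E$ is a finite-dimensional vector space over a field and $r$ is an integer-valued function on the set $\mathcal{L}(E)$ of subspaces of $E$ such that: (R1) $0\le r(A)\le\dim A$ for all $A$; (R2) $A\subseteq B$ implies $r(A)\le r(B)$; (R3) $r(A+B)+r(A\cap B)\le r(A)+r(B)$ for all $A,B$. The notation $r(M;A)$ is the rank of $A$ in the $q$-matroid $M$. Matroid union: for $q$-matroids $N_1,N_2$ on the same ground space $E$, the matroid union $N_1\vee N_2$ is the $q$-matroid on $E$ with rank function $r(A)=\min_{X\subseteq A}\{r(N_1;X)+r(N_2;X)+\dim A-\dim X\}$. Direct sum: let $E=E_1\oplus E_2$. Let $M_1'$ be the $q$-matroid on $E$ obtained from $M_1$ by adding $\dim E_2$ loops, namely with rank function $r(M_1';A)=r(M_1;(A+E_2)\cap E_1)$; let $M_2'$ be the $q$-matroid on $E$ obtained from $M_2$ by adding $\dim E_1$ loops, namely with rank function $r(M_2';A)=r(M_2;(A+E_1)\cap E_2)$. The direct sum is $M_1\oplus M_2:=M_1'\vee M_2'$. *)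

theory Defs
  imports Complex_Main "HOL-Library.Set_Algebras"
begin

text \<open>
  All vector spaces are subspaces of one ambient vector space, whose dimension is arbitrary.
  A \<open>q\<close>-matroid is a pair of its ground space and its rank function; the values of the rank
  function are only meaningful on subspaces of the ground space. The sum of two subspaces is the
  elementwise sum of sets \<open>A + B\<close>.
\<close>

type_synonym 'v qmat = "'v set \<times> ('v set \<Rightarrow> int)"

abbreviation ground :: "'v qmat \<Rightarrow> 'v set"
  where "ground \<equiv> fst"

abbreviation rank :: "'v qmat \<Rightarrow> 'v set \<Rightarrow> int"
  where "rank \<equiv> snd"

definition fin_dim_subspace :: "('k::field \<Rightarrow> 'v::ab_group_add \<Rightarrow> 'v) \<Rightarrow> 'v set \<Rightarrow> bool"
  where "fin_dim_subspace scale V \<longleftrightarrow>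
    module.subspace scale V \<and> (\<exists>B. finite B \<and> V = module.span scale B)"

definition q_matroid :: "('k::field \<Rightarrow> 'v::ab_group_add \<Rightarrow> 'v) \<Rightarrow> 'v qmat \<Rightarrow> bool"
  where "q_matroid scale M \<longleftrightarrow>
    fin_dim_subspace scale (ground M) \<and>
    (\<forall>A. module.subspace scale A \<and> A \<subseteq> ground M \<longrightarrow>
      0 \<le> rank M A \<and> rank M A \<le> int (vector_space.dim scale A)) \<and>
    (\<forall>A B. module.subspace scale A \<and> module.subspace scale B \<and> A \<subseteq> B \<and> B \<subseteq> ground M \<longrightarrow>
      rank M A \<le> rank M B) \<and>
    (\<forall>A B. module.subspace scale A \<and> module.subspace scale B \<and>
      A \<subseteq> ground M \<and> B \<subseteq> ground M \<longrightarrow>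
      rank M (A + B) + rank M (A \<inter> B) \<le> rank M A + rank M B)"

text \<open>Only used for \<open>q\<close>-matroids with the same ground space.\<close>

definition matroid_union ::
    "('k::field \<Rightarrow> 'v::ab_group_add \<Rightarrow> 'v) \<Rightarrow> 'v qmat \<Rightarrow> 'v qmat \<Rightarrow> 'v qmat"
  where "matroid_union scale N1 N2 =
    (ground N1,
     \<lambda>A. Min {rank N1 X + rank N2 X + int (vector_space.dim scale A) - int (vector_space.dim scale X) | X.
       module.subspace scale X \<and> X \<subseteq> A})"

text \<open>
  Over an infinite field the minimum ranges over infinitely many subspaces, but they yield only
  finitely many values, so that \<^const>\<open>Min\<close> is the true minimum.
\<close>

lemma (in vector_space) finite_matroid_union_values:
  assumes N: "q_matroid scale N1" "q_matroid scale N2" "ground N1 = ground N2" and A: "A \<subseteq> ground N1"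
  shows "finite {rank N1 X + rank N2 X + int (dim A) - int (dim X) | X. subspace X \<and> X \<subseteq> A}"
proof -
  have "fin_dim_subspace scale (ground N1)"
    using N(1) unfolding q_matroid_def by (rule conjunct1)
  then obtain B where B: "finite B" "ground N1 = span B"
    unfolding fin_dim_subspace_def by (elim conjE exE)
  have bounds: "0 \<le> rank N X \<and> rank N X \<le> int (dim X)"
    if "q_matroid scale N" "subspace X" "X \<subseteq> ground N" for N X
    using that(1)[unfolded q_matroid_def, THEN conjunct2, THEN conjunct1, rule_format, of X]
      that(2,3) by iprover
  let ?f = "\<lambda>X. rank N1 X + rank N2 X + int (dim A) - int (dim X)"
  let ?I = "{int (dim A) - int (card B)..2 * int (card B) + int (dim A)}"
  have "?f X \<in> ?I" if X: "subspace X" "X \<subseteq> A" for X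
  proof -
    have X1: "X \<subseteq> ground N1"
      using X(2) A by (rule subset_trans)
    then have X2: "X \<subseteq> ground N2"
      by (simp only: N(3))
    have "dim X \<le> card B"
      using X1[unfolded B(2)] B(1) by (rule dim_le_card)
    with bounds[OF N(1) X(1) X1] bounds[OF N(2) X(1) X2] show ?thesis
      unfolding atLeastAtMost_iff by linarith
  qed
  then have "{?f X | X. subspace X \<and> X \<subseteq> A} \<subseteq> ?I"
    by blast
  then show ?thesis
    by (rule finite_subset) (rule finite_atLeastAtMost_int)
qed

text \<open>The \<open>q\<close>-matroid on \<open>ground M + F\<close> obtained from \<open>M\<close> by adding \<open>dim F\<close> loops.\<close>

definition add_loops :: "'v::ab_group_add qmat \<Rightarrow> 'v set \<Rightarrow> 'v qmat"
  where "add_loops M F = (ground M + F, \<lambda>A. rank M ((A + F) \<inter> ground M))"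

definition direct_sum ::
    "('k::field \<Rightarrow> 'v::ab_group_add \<Rightarrow> 'v) \<Rightarrow> 'v qmat \<Rightarrow> 'v qmat \<Rightarrow> 'v qmat"
  where "direct_sum scale M1 M2 =
    matroid_union scale (add_loops M1 (ground M2)) (add_loops M2 (ground M1))"

end

theory Submission
  imports Defs
begin

text \<open>
  The rank of \<open>A = A1 + A2\<close> in \<open>M1 \<oplus> M2\<close> is the minimum, over the subspaces \<open>X\<close> of \<open>A\<close>, of
  \<open>r1 P1 + r2 P2 + dim A - dim X\<close>, where \<open>P1 = (X + E2) \<inter> E1\<close> and \<open>P2 = (X + E1) \<inter> E2\<close> are the
  projections of \<open>X\<close> to the two ground spaces. The choice \<open>X = A\<close> has the projections \<open>A1\<close> and \<open>A2\<close>
  and gives the value \<open>r1 A1 + r2 A2\<close>, so it remains to see that no other \<open>X\<close> does better.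

  Every \<open>X \<subseteq> A\<close> is contained in \<open>P1 + P2\<close>, and \<open>P1 \<subseteq> A1\<close>, \<open>P2 \<subseteq> A2\<close>. Passing from \<open>A\<close> to \<open>X\<close>
  therefore frees at least \<open>(dim A1 - dim P1) + (dim A2 - dim P2)\<close> dimensions, which are charged
  at one unit each. In a \<open>q\<close>-matroid the rank drops by at most the drop in dimension
  (\<open>q_matroid_rank_drop\<close>), so \<open>r1\<close> and \<open>r2\<close> together lose no more than is charged.
\<close>

section \<open>Dimensions of sums\<close>

context vector_space
begin

lemma subspace_set_plus: "subspace S \<Longrightarrow> subspace T \<Longrightarrow> subspace (S + T)"
  using subspace_sums[of S T] by (simp add: set_plus_def Bex_def conj_ac ex_simps)

lemma span_Un_set_plus: "span (B \<union> C) = span B + span C"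
  unfolding span_Un set_plus_def by blast

lemma independent_Un_of_trivial_Int:
  assumes B: "independent B" and C: "independent C" and BC: "span B \<inter> span C = {0}"
  shows "independent (B \<union> C)" and "B \<inter> C = {}"
proof -
  have "B \<inter> C \<subseteq> {0}"
    using BC span_superset by blast
  moreover have "0 \<notin> B"
    using B dependent_zero by blast
  ultimately show disj: "B \<inter> C = {}"
    by blast
  show "independent (B \<union> C)"
    unfolding independent_explicit_module
  proof (intro allI impI)
    fix t u v
    assume t: "finite t" "t \<subseteq> B \<union> C" and zero: "(\<Sum>v\<in>t. u v *s v) = 0" and v: "v \<in> t"
    have fin: "finite (t \<inter> B)" "finite (t \<inter> C)"
      using t by auto
    have split: "t = (t \<inter> B) \<union> (t \<inter> C)"
      using t by blast
    have "(\<Sum>v\<in>t \<inter> B. u v *s v) + (\<Sum>v\<in>t \<inter> C. u v *s v) = (\<Sum>v\<in>t. u v *s v)"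
      by (subst (3) split, rule sum.union_disjoint[symmetric]) (use fin disj in auto)
    then have sum0: "(\<Sum>v\<in>t \<inter> B. u v *s v) + (\<Sum>v\<in>t \<inter> C. u v *s v) = 0"
      using zero by simp
    have inB: "(\<Sum>v\<in>t \<inter> B. u v *s v) \<in> span B"
      by (intro span_sum span_scale) (simp add: span_base)
    have inC: "(\<Sum>v\<in>t \<inter> C. u v *s v) \<in> span C"
      by (intro span_sum span_scale) (simp add: span_base)
    \<comment> \<open>The two partial sums are negatives of each other, so both lie in both spans.\<close>
    have "(\<Sum>v\<in>t \<inter> B. u v *s v) \<in> span C"
      using span_neg[OF inC] sum0 by (simp add: eq_neg_iff_add_eq_0[symmetric])
    then have B0: "(\<Sum>v\<in>t \<inter> B. u v *s v) = 0"
      using inB BC by blast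
    then have C0: "(\<Sum>v\<in>t \<inter> C. u v *s v) = 0"
      using sum0 by simp
    from v t consider "v \<in> t \<inter> B" | "v \<in> t \<inter> C"
      by blast
    then show "u v = 0"
      using independentD[OF B fin(1) _ B0] independentD[OF C fin(2) _ C0] by cases auto
  qed
qed

text \<open>
  The ambient space may have infinite dimension, and \<^const>\<open>dim\<close> is \<open>0\<close> on its
  infinite-dimensional subspaces. A finite-dimensional \<open>E\<close> around \<open>S\<close> makes \<open>dim S\<close> the true
  dimension: a basis of \<open>S\<close> is at most as large as a finite spanning set of \<open>E\<close>.
\<close>

lemma fin_dim_subspace_basis:
  assumes E: "fin_dim_subspace scale E" and S: "subspace S" "S \<subseteq> E"
  obtains B where "finite B" "independent B" "B \<subseteq> S" "span B = S" "dim S = card B"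
proof -
  obtain G where G: "finite G" "E = span G"
    using E unfolding fin_dim_subspace_def by blast
  obtain B where B: "B \<subseteq> S" "independent B" "S \<subseteq> span B" "card B = dim S"
    using basis_exists by blast
  moreover have "finite B"
    using independent_span_bound[OF G(1) B(2)] B(1) S(2) G(2) by blast
  moreover have "span B = S"
    using span_subspace[OF B(1,3) S(1)] .
  ultimately show thesis
    using that by metis
qed

lemma dim_set_plus_direct:
  assumes "fin_dim_subspace scale E" "subspace S" "S \<subseteq> E"
    and "fin_dim_subspace scale F" "subspace T" "T \<subseteq> F" and ST: "S \<inter> T = {0}"
  shows "dim (S + T) = dim S + dim T"
proof -
  obtain B where B: "finite B" "independent B" "span B = S" "dim S = card B"
    using fin_dim_subspace_basis[OF assms(1-3)] by metis
  obtain C where C: "finite C" "independent C" "span C = T" "dim T = card C"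
    using fin_dim_subspace_basis[OF assms(4-6)] by metis
  have BC: "span B \<inter> span C = {0}"
    using B(3) C(3) ST by simp
  have "dim (S + T) = dim (span (B \<union> C))"
    by (simp add: span_Un_set_plus B C)
  also have "\<dots> = card (B \<union> C)"
    using independent_Un_of_trivial_Int(1)[OF B(2) C(2) BC] by (rule dim_span_eq_card_independent)
  also have "\<dots> = card B + card C"
    using independent_Un_of_trivial_Int(2)[OF B(2) C(2) BC] B(1) C(1) by (simp add: card_Un_disjoint)
  finally show ?thesis
    by (simp add: B C)
qed

lemma dim_le_of_subset_set_plus:
  assumes "fin_dim_subspace scale E" "subspace S" "S \<subseteq> E"
    and "fin_dim_subspace scale F" "subspace T" "T \<subseteq> F" and X: "X \<subseteq> S + T"
  shows "dim X \<le> dim S + dim T"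
proof -
  obtain B where B: "finite B" "span B = S" "dim S = card B"
    using fin_dim_subspace_basis[OF assms(1-3)] by metis
  obtain C where C: "finite C" "span C = T" "dim T = card C"
    using fin_dim_subspace_basis[OF assms(4-6)] by metis
  have "dim X \<le> card (B \<union> C)"
    using X B C by (intro dim_le_card) (simp_all add: span_Un_set_plus)
  also have "\<dots> \<le> dim S + dim T"
    using card_Un_le B C by metis
  finally show ?thesis .
qed

text \<open>
  A basis \<open>B\<close> of \<open>P\<close> extends to a basis \<open>D\<close> of \<open>A\<close>, and \<open>D - B\<close> spans the complement.
\<close>

lemma complement_in_fin_dim_subspace:
  assumes E: "fin_dim_subspace scale E" and A: "subspace A" "A \<subseteq> E" and P: "subspace P" "P \<subseteq> A"
  obtains C where "subspace C" "C \<subseteq> A" "P + C = A" "dim P + dim C = dim A"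
proof -
  obtain B where B: "finite B" "independent B" "B \<subseteq> P" "span B = P" "dim P = card B"
    using fin_dim_subspace_basis[OF E P(1)] P(2) A(2) by (metis subset_trans)
  obtain D where D: "B \<subseteq> D" "D \<subseteq> A" "independent D" "A \<subseteq> span D"
    using maximal_independent_subset_extend[of B A] B P by blast
  obtain G where G: "finite G" "E = span G"
    using E unfolding fin_dim_subspace_def by blast
  have finD: "finite D"
    using independent_span_bound[OF G(1) D(3)] D(2) A(2) G(2) by blast
  have spanD: "span D = A"
    using span_subspace[OF D(2,4) A(1)] .
  show thesis
  proof (rule that[of "span (D - B)"])
    show "span (D - B) \<subseteq> A"
      using span_mono[of "D - B" D] spanD by blast
    show "P + span (D - B) = A"
      using span_Un_set_plus[of B "D - B"] B(4) D(1) spanD by (simp add: Un_absorb1)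
    have "dim (span (D - B)) = card (D - B)"
      using independent_mono[OF D(3)] by (intro dim_span_eq_card_independent) auto
    moreover have "dim A = card D"
      using dim_span_eq_card_independent[OF D(3)] spanD by simp
    ultimately show "dim P + dim (span (D - B)) = dim A"
      using B(5) card_Diff_subset[OF B(1) D(1)] card_mono[OF finD D(1)] by simp
  qed simp
qed

section \<open>The rank of a direct sum\<close>

text \<open>
  Submodularity for \<open>P\<close> and a complement \<open>C\<close> of \<open>P\<close> in \<open>A\<close> gives \<open>r A \<le> r P + r C\<close>, and \<open>r C\<close>
  is at most \<open>dim C = dim A - dim P\<close>.
\<close>

lemma q_matroid_rank_drop:
  assumes M: "q_matroid scale M" and A: "subspace A" "A \<subseteq> ground M" and P: "subspace P" "P \<subseteq> A"
  shows "rank M A + int (dim P) \<le> rank M P + int (dim A)"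
proof -
  have E: "fin_dim_subspace scale (ground M)"
    and bounds: "\<And>S. subspace S \<Longrightarrow> S \<subseteq> ground M \<Longrightarrow> 0 \<le> rank M S \<and> rank M S \<le> int (dim S)"
    and submod: "\<And>S T. subspace S \<Longrightarrow> subspace T \<Longrightarrow> S \<subseteq> ground M \<Longrightarrow> T \<subseteq> ground M \<Longrightarrow>
      rank M (S + T) + rank M (S \<inter> T) \<le> rank M S + rank M T"
    using M unfolding q_matroid_def by blast+
  obtain C where C: "subspace C" "C \<subseteq> A" "P + C = A" "dim P + dim C = dim A"
    using complement_in_fin_dim_subspace[OF E A P] .
  have sub: "P \<subseteq> ground M" "C \<subseteq> ground M"
    using P(2) C(2) A(2) by blast+
  have "rank M A + rank M (P \<inter> C) \<le> rank M P + rank M C"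
    using submod[OF P(1) C(1) sub] C(3) by simp
  moreover have "0 \<le> rank M (P \<inter> C)"
    using bounds[OF subspace_inter[OF P(1) C(1)]] sub by blast
  moreover have "rank M C \<le> int (dim C)"
    using bounds[OF C(1) sub(2)] by blast
  ultimately show ?thesis
    using C(4) by linarith
qed

text \<open>
  The left-hand side is the projection of \<open>A1 + A2\<close> to \<open>E1\<close> along \<open>E2\<close>. It is \<open>A1\<close> because
  the \<open>E1\<close>-component of a vector is unique.
\<close>

lemma projection_direct_sum:
  assumes E: "subspace E1" "subspace E2" "E1 \<inter> E2 = {0}"
    and A: "subspace A1" "A1 \<subseteq> E1" "subspace A2" "A2 \<subseteq> E2"
  shows "(A1 + A2 + E2) \<inter> E1 = A1"
proof
  show "(A1 + A2 + E2) \<inter> E1 \<subseteq> A1"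
  proof
    fix p assume "p \<in> (A1 + A2 + E2) \<inter> E1"
    then obtain a b e where p: "p = a + b + e" "a \<in> A1" "b \<in> A2" "e \<in> E2" "p \<in> E1"
      by (auto elim!: set_plus_elim)
    have "b + e \<in> E2"
      using subspace_add[OF E(2)] p(3,4) A(4) by blast
    moreover have "b + e = p - a"
      using p(1) by simp
    then have "b + e \<in> E1"
      using subspace_diff[OF E(1) p(5)] p(2) A(2) by auto
    ultimately have "b + e = 0"
      using E(3) by blast
    then show "p \<in> A1"
      using p(1,2) by (simp add: add.assoc)
  qed
  show "A1 \<subseteq> (A1 + A2 + E2) \<inter> E1"
  proof
    fix a assume a: "a \<in> A1"
    have "a + 0 + 0 \<in> A1 + A2 + E2"
      using a subspace_0[OF A(3)] subspace_0[OF E(2)] by (intro set_plus_intro)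
    then show "a \<in> (A1 + A2 + E2) \<inter> E1"
      using a A(2) by auto
  qed
qed

lemma subset_sum_of_projections:
  assumes E: "subspace E1" "subspace E2" and X: "X \<subseteq> E1 + E2"
  shows "X \<subseteq> ((X + E2) \<inter> E1) + ((X + E1) \<inter> E2)"
proof
  fix x assume x: "x \<in> X"
  then obtain a b where ab: "x = a + b" "a \<in> E1" "b \<in> E2"
    using X by (auto elim!: set_plus_elim)
  have "x + (- b) \<in> X + E2" "x + (- a) \<in> X + E1"
    using set_plus_intro[OF x subspace_neg[OF E(2) ab(3)]]
      set_plus_intro[OF x subspace_neg[OF E(1) ab(2)]] .
  then have "a \<in> (X + E2) \<inter> E1" "b \<in> (X + E1) \<inter> E2"
    using ab by auto
  then show "x \<in> ((X + E2) \<inter> E1) + ((X + E1) \<inter> E2)"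
    unfolding ab(1) by (rule set_plus_intro)
qed

text \<open>
  The first bound says that no \<open>X\<close> gives less than \<open>X = A1 + A2\<close>: the two rank drops are at most
  \<open>dim A1 - dim P1\<close> and \<open>dim A2 - dim P2\<close>, and these add up to at most \<open>dim (A1 + A2) - dim X\<close>.
  The second bound is crude; with the first it confines the integer values to a finite interval,
  so that the \<^const>\<open>Min\<close> in \<^const>\<open>matroid_union\<close> is a true minimum even over an infinite field.
\<close>

lemma direct_sum_value_bounds:
  assumes M1: "q_matroid scale M1" and M2: "q_matroid scale M2"
    and tri: "ground M1 \<inter> ground M2 = {0}"
    and A1: "subspace A1" "A1 \<subseteq> ground M1" and A2: "subspace A2" "A2 \<subseteq> ground M2"
    and X: "subspace X" "X \<subseteq> A1 + A2"
  defines "P1 \<equiv> (X + ground M2) \<inter> ground M1" and "P2 \<equiv> (X + ground M1) \<inter> ground M2"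
  shows "rank M1 A1 + rank M2 A2 \<le> rank M1 P1 + rank M2 P2 + int (dim (A1 + A2)) - int (dim X)"
    and "rank M1 P1 + rank M2 P2 + int (dim (A1 + A2)) - int (dim X)
      \<le> rank M1 A1 + rank M2 A2 + int (dim (A1 + A2))"
proof -
  have E1: "fin_dim_subspace scale (ground M1)" and E2: "fin_dim_subspace scale (ground M2)"
    using M1 M2 unfolding q_matroid_def by blast+
  then have S1: "subspace (ground M1)" and S2: "subspace (ground M2)"
    unfolding fin_dim_subspace_def by blast+
  have tri': "ground M2 \<inter> ground M1 = {0}"
    using tri by blast
  have P1: "subspace P1" and P2: "subspace P2"
    unfolding P1_def P2_def by (intro subspace_inter subspace_set_plus X S1 S2)+
  have "P1 \<subseteq> (A1 + A2 + ground M2) \<inter> ground M1"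
    unfolding P1_def using set_plus_mono2[OF X(2) subset_refl] by blast
  then have PA1: "P1 \<subseteq> A1"
    unfolding projection_direct_sum[OF S1 S2 tri A1 A2] .
  have "P2 \<subseteq> (A2 + A1 + ground M1) \<inter> ground M2"
    unfolding P2_def add.commute[of A2 A1] using set_plus_mono2[OF X(2) subset_refl] by blast
  then have PA2: "P2 \<subseteq> A2"
    unfolding projection_direct_sum[OF S2 S1 tri' A2 A1] .
  have "X \<subseteq> ground M1 + ground M2"
    using X(2) set_plus_mono2[OF A1(2) A2(2)] by blast
  then have "X \<subseteq> P1 + P2"
    unfolding P1_def P2_def by (rule subset_sum_of_projections[OF S1 S2])
  then have "dim X \<le> dim P1 + dim P2"
    using dim_le_of_subset_set_plus[OF E1 P1 _ E2 P2] PA1 PA2 A1(2) A2(2) by blast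
  moreover have "dim (A1 + A2) = dim A1 + dim A2"
  proof (rule dim_set_plus_direct[OF E1 A1 E2 A2])
    show "A1 \<inter> A2 = {0}"
      using tri A1(2) A2(2) subspace_0[OF A1(1)] subspace_0[OF A2(1)] by blast
  qed
  ultimately show
    "rank M1 A1 + rank M2 A2 \<le> rank M1 P1 + rank M2 P2 + int (dim (A1 + A2)) - int (dim X)"
    using q_matroid_rank_drop[OF M1 A1 P1 PA1] q_matroid_rank_drop[OF M2 A2 P2 PA2] by linarith
  have "rank M1 P1 \<le> rank M1 A1" "rank M2 P2 \<le> rank M2 A2"
    using M1 M2 P1 P2 PA1 PA2 A1 A2 unfolding q_matroid_def by blast+
  then show "rank M1 P1 + rank M2 P2 + int (dim (A1 + A2)) - int (dim X)
      \<le> rank M1 A1 + rank M2 A2 + int (dim (A1 + A2))"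
    by linarith
qed

lemma rank_direct_sum:
  assumes M1: "q_matroid scale M1" and M2: "q_matroid scale M2"
    and tri: "ground M1 \<inter> ground M2 = {0}"
    and A1: "subspace A1" "A1 \<subseteq> ground M1" and A2: "subspace A2" "A2 \<subseteq> ground M2"
  shows "rank (direct_sum scale M1 M2) (A1 + A2) = rank M1 A1 + rank M2 A2"
proof -
  have S1: "subspace (ground M1)" and S2: "subspace (ground M2)"
    using M1 M2 unfolding q_matroid_def fin_dim_subspace_def by blast+
  have tri': "ground M2 \<inter> ground M1 = {0}"
    using tri by blast
  let ?f = "\<lambda>X. rank M1 ((X + ground M2) \<inter> ground M1) + rank M2 ((X + ground M1) \<inter> ground M2)
    + int (dim (A1 + A2)) - int (dim X)"
  let ?r = "rank M1 A1 + rank M2 A2"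
  let ?V = "{?f X | X. subspace X \<and> X \<subseteq> A1 + A2}"
  note bounds = direct_sum_value_bounds[OF M1 M2 tri A1 A2]
  have "Min ?V = ?r"
  proof (rule Min_eqI)
    have "?V \<subseteq> {?r..?r + int (dim (A1 + A2))}"
      using bounds by auto
    then show "finite ?V"
      by (rule finite_subset) (rule finite_atLeastAtMost_int)
    show "?r \<le> y" if "y \<in> ?V" for y
      using that bounds(1) by auto
    have "?f (A1 + A2) = ?r"
      using projection_direct_sum[OF S1 S2 tri A1 A2] projection_direct_sum[OF S2 S1 tri' A2 A1]
      by (simp add: add.commute[of A2 A1])
    then show "?r \<in> ?V"
      using subspace_set_plus[OF A1(1) A2(1)] by force
  qed
  then show ?thesis
    by (simp add: direct_sum_def matroid_union_def add_loops_def)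
qed

end

theorem theorem47:
  fixes scale :: "'k::field \<Rightarrow> 'v::ab_group_add \<Rightarrow> 'v"
    and M1 M2 :: "'v qmat" and A A1 A2 :: "'v set"
  assumes "vector_space scale"
    and "q_matroid scale M1" and "q_matroid scale M2"
    and "ground M1 \<inter> ground M2 = {0}"
    and "module.subspace scale A1" and "A1 \<subseteq> ground M1"
    and "module.subspace scale A2" and "A2 \<subseteq> ground M2"
    and "A = A1 + A2"
  shows "rank (direct_sum scale M1 M2) A = rank M1 A1 + rank M2 A2"
proof -
  interpret vector_space scale by fact
  show ?thesis
    unfolding \<open>A = A1 + A2\<close> by (rule rank_direct_sum) fact+
qed

end
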